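(* Let $m\ge1$ and $n\ge1$ be integers. For $0\le s\le m-1$ define $$G_{m,s}(q)=\frac{\prod_{j=0}^{s}(1+q^{m-j})}{(1-q)^{2s}}\sum_{k=0}^{s}\frac{(-1)^{s-k}}{1+q^{m-k}}\binom{2m}{k}\sum_{i=0}^{s-k}\frac{m-k}{m-s}\binom{m-s+i-1}{i}\binom{m-k-i-1}{s-k-i}q^{s-k-i}.$$ Then each $G_{m,s}(q)$ is a polynomial in $\mathbb{Z}[q]$, and $$T_{2m,n}(q)=\sum_{k=0}^{m-1}(-1)^kG_{m,k}(q)\frac{(1-q^n)^{m-k}(1-q^{n+1})^{m-k}q^{kn}}{(1-q)^{2m-2k}\prod_{i=0}^{k}(1+q^{m-i})}.$$
   Context: $q$ is an indeterminate and $q^{1/2}$ a fixed formal square root of $q$; identities are identities of rational functions in $q^{1/2}$. For integers $m,n\ge1$, $$T_{m,n}(q)=\sum_{k=1}^{n}(-1)^{n-k}\left(\frac{1-q^k}{1-q}\right)^{m}q^{\frac m2(n-k)}.$$ Binomial coefficients $\binom{a}{b}$ with integers $a,b$ are taken to be $0$ when $b<0$ or when $0\le a<b$. *)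

theory Defs
  imports "HOL-Computational_Algebra.Polynomial" "HOL-Computational_Algebra.Fraction_Field"
begin

text \<open>Rational functions in the formal square root of q: the field of fractions of Z[x],
  where x stands for q^(1/2) and q = x^2.\<close>

definition qh :: "int poly fract" where
  "qh = Fract [:0, 1:] 1"

definition qq :: "int poly fract" where
  "qq = qh ^ 2"

definition poly_in_q :: "int poly \<Rightarrow> int poly fract" where
  "poly_in_q p = Fract (pcompose p [:0, 0, 1:]) 1"

text \<open>T_{m,n}(q); the factor q^{(m/2)(n-k)} is (q^{1/2})^{m(n-k)}.\<close>
definition T :: "nat \<Rightarrow> nat \<Rightarrow> int poly fract" where
  "T m n = (\<Sum>k = 1..n. (-1) ^ (n - k) * ((1 - qq ^ k) / (1 - qq)) ^ m * qh ^ (m * (n - k)))"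

definition G :: "nat \<Rightarrow> nat \<Rightarrow> int poly fract" where
  "G m s = (\<Prod>j = 0..s. 1 + qq ^ (m - j)) / (1 - qq) ^ (2 * s) *
     (\<Sum>k = 0..s. (-1) ^ (s - k) / (1 + qq ^ (m - k)) * of_nat ((2 * m) choose k) *
        (\<Sum>i = 0..s - k. of_nat (m - k) / of_nat (m - s) * of_nat ((m - s + i - 1) choose i)
            * of_nat ((m - k - i - 1) choose (s - k - i)) * qq ^ (s - k - i)))"

end

theory Submission
  imports Defs "HOL-Computational_Algebra.Formal_Power_Series"
    "HOL-Computational_Algebra.Polynomial_Factorial"
begin

text \<open>Expanding \<open>(1 - q^k)^(2m)\<close> and summing over \<open>k\<close> gives, with \<open>x = q^n\<close>, the sum of
  \<open>(-1)^j binom(2m,j) (qx)^j / (q^j + q^m)\<close> over \<open>j \<le> 2m\<close>; the boundary terms at \<open>k = 0\<close> cancel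
  under \<open>j \<leftrightarrow> 2m - j\<close>. Pairing \<open>j\<close> with \<open>2m - j\<close> and dividing by \<open>x^m\<close> leaves the power sums
  \<open>(1/x)^d + (qx)^d\<close> with \<open>d = m - j\<close>. These are polynomials in \<open>w = (1 - x)(1 - qx)/x\<close>, since the two
  bases have sum \<open>w + 1 + q\<close> and product \<open>q\<close>, and their coefficients are the inner sums of
  \<open>G\<close>. This is the claimed identity.

  For integrality, the coefficients of the power sums satisfy a recurrence over \<open>Z[q]\<close>, so only the
  denominator \<open>(1 - q)^(2s)\<close> matters. As \<open>T\<close> is a polynomial for every \<open>n\<close>, a leading
  pole at \<open>q = 1\<close> of the coefficients would give a nontrivial polynomial vanishing at \<open>n(n+1)\<close> for
  all \<open>n\<close>.\<close>

section \<open>Coefficients of power sums \<open>a ^ d + b ^ d\<close> with fixed product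
  \<open>a * b = q\<close>\<close>

unbundle fps_syntax

text \<open>The coefficient of \<open>w ^ r\<close> in \<open>a ^ d + b ^ d\<close> when
  \<open>a * b = q\<close> and \<open>a + b = w + 1 + q\<close>. At \<open>w = 0\<close> the bases
  are 1 and \<open>q\<close>, hence the case \<open>r = 0\<close>; for \<open>0 < r \<le> d\<close>
  it is the inner sum of \<open>G\<close>. The case \<open>d < r\<close> must be explicit, since
  truncated subtraction would turn the formula into \<open>d / r\<close>.\<close>

definition lucas_coeff :: "'a::field_char_0 \<Rightarrow> nat \<Rightarrow> nat \<Rightarrow> 'a" where
  "lucas_coeff q d r =
     (if r = 0 then 1 + q ^ d else if d < r then 0
      else of_nat d / of_nat r *
        (\<Sum>i = 0..d - r. of_nat ((r + i - 1) choose i) * of_nat ((d - i - 1) choose (d - r - i))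
           * q ^ (d - r - i)))"

text \<open>The power is a product of two negative binomial series, in \<open>X\<close> and in
  \<open>q X\<close>; the sum is their Cauchy product.\<close>

lemma nth_inverse_quadratic_power:
  fixes q :: "'a::field_char_0"
  assumes "r > 0"
  shows "inverse ((1 - fps_X) * (1 - fps_const q * fps_X)) ^ r $ n =
    (\<Sum>i = 0..n. of_nat ((r + i - 1) choose i) * (of_nat ((r + (n - i) - 1) choose (n - i)) * q ^ (n - i)))"
proof -
  have "inverse ((1 - fps_X) * (1 - fps_const q * fps_X)) ^ r =
      inverse ((1 - fps_const (1::'a) * fps_X) ^ r) * inverse ((1 - fps_const q * fps_X) ^ r)"
    by (simp add: fps_inverse_mult fps_inverse_power power_mult_distrib)
  then show ?thesis
    by (simp only: one_minus_const_fps_X_neg_power'[OF assms] fps_mult_nth fps_nth_Abs_fps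
        power_one mult_1_right)
qed

text \<open>The operator \<open>X d/dX\<close> multiplies the coefficient of \<open>X ^ d\<close> by
  \<open>d\<close>, and applied to \<open>F ^ r\<close> it gives
  \<open>r F ^ (r - 1) (X F')\<close>; this accounts for the factor \<open>d / r\<close>. Hence the
  generating functions for successive \<open>r > 0\<close> differ by the factor
  \<open>F\<close>.\<close>

lemma fps_lucas_coeff:
  fixes q :: "'a::field_char_0"
  assumes "r > 0"
  defines "F \<equiv> fps_X * inverse ((1 - fps_X) * (1 - fps_const q * fps_X))"
  shows "Abs_fps (\<lambda>d. lucas_coeff q d r) = F ^ (r - 1) * (fps_X * fps_deriv F)"
proof (rule fps_ext)
  fix d
  \<comment> \<open>The factor \<open>X ^ r\<close> of \<open>F ^ r\<close> shifts the index to
    \<open>d - r\<close>, and \<open>r + (d - r - i) - 1 = d - i - 1\<close>.\<close>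
  have nth: "F ^ r $ d = (if d < r then 0 else
      (\<Sum>i = 0..d - r. of_nat ((r + i - 1) choose i) *
         of_nat ((d - i - 1) choose (d - r - i)) * q ^ (d - r - i)))"
    using assms(1) unfolding F_def power_mult_distrib fps_X_power_mult_nth
    by (auto simp: nth_inverse_quadratic_power mult.assoc intro!: sum.cong)
  have "of_nat r * (F ^ (r - 1) * (fps_X * fps_deriv F)) = fps_X * fps_deriv (F ^ r)"
    by (simp add: fps_deriv_power' fps_of_nat mult_ac)
  from arg_cong[OF this, of "\<lambda>f. f $ d"]
  have "of_nat r * (F ^ (r - 1) * (fps_X * fps_deriv F)) $ d = of_nat d * F ^ r $ d"
    by (simp only: fps_mult_fps_X_deriv_shift[of "F ^ r"] fps_of_nat[symmetric]
          fps_mult_left_const_nth fps_nth_Abs_fps)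
  moreover have "y = b / a * x" if "a * y = b * x" "a \<noteq> 0" for a b x y :: 'a
    using that by (simp add: field_simps)
  ultimately have "(F ^ (r - 1) * (fps_X * fps_deriv F)) $ d = of_nat d / of_nat r * F ^ r $ d"
    using assms(1) by simp
  moreover have "lucas_coeff q d r = of_nat d / of_nat r * F ^ r $ d"
    using assms(1) by (simp add: lucas_coeff_def nth)
  ultimately show "Abs_fps (\<lambda>d. lucas_coeff q d r) $ d = (F ^ (r - 1) * (fps_X * fps_deriv F)) $ d"
    by simp
qed

lemma lucas_coeff_eq_0: "d < r \<Longrightarrow> lucas_coeff q d r = 0"
  by (simp add: lucas_coeff_def)

lemma lucas_coeff_one: "lucas_coeff q d 1 = of_nat d * (\<Sum>i<d. q ^ i)"
proof (cases d)
  case (Suc k)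
  have "(\<Sum>i = 0..k. q ^ (k - i)) = (\<Sum>i<Suc k. q ^ i)"
    using sum.nat_diff_reindex[of "\<lambda>i. q ^ i" "Suc k"]
    by (simp add: atLeast0AtMost lessThan_Suc_atMost)
  then show ?thesis
    by (simp add: lucas_coeff_def Suc)
qed (simp add: lucas_coeff_def)

text \<open>This is \<open>a ^ (d + 2) + b ^ (d + 2) = (a + b) (a ^ (d + 1) + b ^ (d + 1)) - a b (a
  ^ d + b ^ d)\<close> read off at \<open>w ^ r\<close>, but it is proved from the closed form, so
  that the power sums can be deduced from it.\<close>

lemma lucas_coeff_rec:
  fixes q :: "'a::field_char_0"
  shows "lucas_coeff q (d + 2) r = (if r = 0 then 0 else lucas_coeff q (d + 1) (r - 1))
    + (1 + q) * lucas_coeff q (d + 1) r - q * lucas_coeff q d r"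
proof -
  \<comment> \<open>The column \<open>r = 0\<close> is not of the form
    \<open>F ^ (r - 1) (X F')\<close>, so generating functions apply only when both \<open>r\<close>
    and \<open>r - 1\<close> are positive.\<close>
  consider "r = 0" | "r = 1" | "r \<ge> 2" by linarith
  then show ?thesis
  proof cases
    case 1
    then show ?thesis by (simp add: lucas_coeff_def algebra_simps)
  next
    case 2
    define s where "s d = (\<Sum>i<d. q ^ i)" for d
    have s1: "s (Suc (Suc d)) = s d + q ^ d + q ^ (d + 1)" "s (Suc d) = s d + q ^ d"
      by (simp_all add: s_def)
    have s2: "q * s d = s d + q ^ d - 1"
      unfolding s_def by (induction d) (simp_all add: algebra_simps)
    have *: "lucas_coeff q d (Suc 0) = of_nat d * s d" for d
      using lucas_coeff_one[of q d] by (simp add: s_def)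
    have "lucas_coeff q (d + 2) 1 - (1 + q ^ (d + 1)
        + (1 + q) * lucas_coeff q (d + 1) 1 - q * lucas_coeff q d 1) = 
       of_nat (d+2) * s (Suc (Suc d)) 
       - (1 + q ^ (d + 1) + (1 + q) * of_nat (d+1) * s (Suc d) - of_nat d * (q * s d))"
      by (simp add: * algebra_simps)
    also have "\<dots> = s d - q * s d + q ^ d - 1"
      unfolding s1 by (simp add: algebra_simps)
    also have "\<dots> = 0" by (simp add: s2)
    finally show ?thesis
      using 2 by (simp add: lucas_coeff_def)
  next
    case 3
    define P where "P = (1 - fps_X) * (1 - fps_const q * fps_X)"
    define F where "F = fps_X * inverse P"
    have "P $ 0 \<noteq> 0" by (simp add: P_def)
    then have PF: "P * F = fps_X"
      by (simp add: F_def inverse_mult_eq_1' mult.left_commute)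
    obtain k where r: "r = Suc (Suc k)"
      using 3 by (metis add_2_eq_Suc le_Suc_ex)
    let ?C = "\<lambda>r. Abs_fps (\<lambda>d. lucas_coeff q d r)"
    \<comment> \<open>One factor \<open>F\<close> is absorbed by \<open>P * F = X\<close>.\<close>
    have PC: "P * ?C r = fps_X * ?C (r - 1)"
      using fps_lucas_coeff[of r q] fps_lucas_coeff[of "r - 1" q] PF
      by (simp add: r flip: P_def F_def)
    have P_eq: "P = 1 - fps_const (1 + q) * fps_X + fps_const q * fps_X ^ 2"
      by (simp add: P_def algebra_simps power2_eq_square flip: fps_const_add)
    have distrib: "(1 - u * X + v * X ^ 2) * f = f - u * (X * f) + v * (X ^ 2 * f)" for u v X f :: "'a fps"
      by (simp add: algebra_simps)
    have "?C r - fps_const (1 + q) * (fps_X * ?C r) + fps_const q * (fps_X ^ 2 * ?C r)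
        = fps_X * ?C (r - 1)"
      using PC unfolding P_eq distrib .
    from arg_cong[OF this, of "\<lambda>f. f $ (d + 2)"]
    have "lucas_coeff q (d + 2) r - (1 + q) * lucas_coeff q (d + 1) r + q * lucas_coeff q d r
        = lucas_coeff q (d + 1) (r - 1)"
      by (simp only: fps_add_nth fps_sub_nth fps_mult_left_const_nth fps_X_mult_nth
            fps_X_power_mult_nth fps_nth_Abs_fps) simp
    moreover have "x = z + y - w" if "x - y + w = z" for x y z w :: 'a
      using that by (simp add: algebra_simps)
    ultimately have "lucas_coeff q (d + 2) r = lucas_coeff q (d + 1) (r - 1)
        + (1 + q) * lucas_coeff q (d + 1) r - q * lucas_coeff q d r"
      by blast
    then show ?thesis
      using 3 by simp
  qed
qed

text \<open>Both sides satisfy the same second-order recurrence in \<open>d\<close>. Any bound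
  \<open>N \<ge> d\<close> is allowed because the coefficients beyond \<open>d\<close> vanish; the
  induction step uses both \<open>N\<close> and \<open>N - 1\<close>.\<close>

lemma power_sum_lucas_coeff:
  fixes a b q w :: "'a::field_char_0"
  assumes ab: "a * b = q" and w: "a + b = w + 1 + q"
  shows "d \<le> N \<Longrightarrow> a ^ d + b ^ d = (\<Sum>r\<le>N. lucas_coeff q d r * w ^ r)"
proof (induction d arbitrary: N rule: induct_nat_012)
  case 0
  have "(\<Sum>r\<le>N. lucas_coeff q 0 r * w ^ r) = (\<Sum>r\<in>{0}. lucas_coeff q 0 r * w ^ r)"
    by (rule sum.mono_neutral_right) (auto simp: lucas_coeff_eq_0)
  then show ?case by (simp add: lucas_coeff_def)
next
  case 1
  have "(\<Sum>r\<le>N. lucas_coeff q 1 r * w ^ r) = (\<Sum>r\<in>{0, 1}. lucas_coeff q 1 r * w ^ r)"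
    using 1 by (intro sum.mono_neutral_right) (auto simp: lucas_coeff_eq_0)
  then show ?case using w by (simp add: lucas_coeff_def)
next
  case (ge2 d)
  then obtain M where N: "N = Suc M" by (cases N) auto
  have "(\<Sum>r\<le>N. lucas_coeff q (d + 2) r * w ^ r)
      = (\<Sum>r\<le>N. (if r = 0 then 0 else lucas_coeff q (d + 1) (r - 1)) * w ^ r)
        + (1 + q) * (\<Sum>r\<le>N. lucas_coeff q (d + 1) r * w ^ r)
        - q * (\<Sum>r\<le>N. lucas_coeff q d r * w ^ r)"
    unfolding lucas_coeff_rec sum_distrib_left sum.distrib[symmetric] sum_subtractf[symmetric]
    by (intro sum.cong) (simp_all add: algebra_simps)
  also have "(\<Sum>r\<le>N. (if r = 0 then 0 else lucas_coeff q (d + 1) (r - 1)) * w ^ r)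
      = w * (\<Sum>r\<le>M. lucas_coeff q (d + 1) r * w ^ r)"
    unfolding N by (subst sum.atMost_Suc_shift) (simp add: sum_distrib_left mult_ac)
  also have "(\<Sum>r\<le>M. lucas_coeff q (d + 1) r * w ^ r) = a ^ (d + 1) + b ^ (d + 1)"
    using ge2 N by simp
  also have "(\<Sum>r\<le>N. lucas_coeff q (d + 1) r * w ^ r) = a ^ (d + 1) + b ^ (d + 1)"
    using ge2.IH(2)[of N] ge2.prems by simp
  also have "(\<Sum>r\<le>N. lucas_coeff q d r * w ^ r) = a ^ d + b ^ d"
    using ge2.IH(1)[of N] ge2.prems by simp
  also have "w * (a ^ (d + 1) + b ^ (d + 1)) + (1 + q) * (a ^ (d + 1) + b ^ (d + 1)) - q * (a ^ d + b ^ d)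
      = (a + b) * (a ^ (d + 1) + b ^ (d + 1)) - a * b * (a ^ d + b ^ d)"
    unfolding ab w by (simp add: algebra_simps)
  also have "\<dots> = a ^ (d + 2) + b ^ (d + 2)"
    by (simp add: algebra_simps)
  finally show ?case by simp
qed

section \<open>Alternating binomial sums and the alternating sum of q-powers\<close>

lemma sum_atMost_double:
  fixes f :: "nat \<Rightarrow> 'a::comm_monoid_add"
  shows "(\<Sum>j\<le>2 * m. f j) = (\<Sum>j<m. f j + f (2 * m - j)) + f m"
proof -
  have "(\<Sum>j\<in>{m<..2 * m}. f j) = (\<Sum>j<m. f (2 * m - j))"
    by (rule sum.reindex_bij_witness[of _ "\<lambda>j. 2 * m - j" "\<lambda>j. 2 * m - j"]) auto
  moreover have "{..2 * m} = {..<m} \<union> {m<..2 * m} \<union> {m}"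
    by auto
  moreover have "(\<Sum>j\<in>{..<m} \<union> {m<..2 * m} \<union> {m}. f j)
      = ((\<Sum>j<m. f j) + (\<Sum>j\<in>{m<..2 * m}. f j)) + f m"
    by (subst sum.union_disjoint; auto)+
  ultimately show ?thesis
    by (simp add: sum.distrib)
qed

lemma minus_one_power_diff_double: "j \<le> 2 * m \<Longrightarrow> (-1) ^ (2 * m - j) = ((-1) ^ j :: 'a::ring_1)"
  by (cases "even j") (auto simp: uminus_power_if)

text \<open>The full alternating row sum is 0 and is symmetric about its middle term. This value
  later cancels the middle term of the expansion.\<close>

lemma sum_alternating_binomial_half:
  assumes "m > 0"
  shows "(\<Sum>j<m. (-1) ^ j * of_nat (2 * m choose j))
    = - ((-1) ^ m * of_nat (2 * m choose m) / 2 :: 'a::field_char_0)"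
proof -
  have "(0 :: 'a) = (\<Sum>j\<le>2 * m. (-1) ^ j * of_nat (2 * m choose j))"
    using assms by (simp add: choose_alternating_sum)
  also have "\<dots> = (\<Sum>j<m. 2 * ((-1) ^ j * of_nat (2 * m choose j))) + (-1) ^ m * of_nat (2 * m choose m)"
    unfolding sum_atMost_double
    by (intro arg_cong2[of _ _ _ _ "(+)"] sum.cong refl)
       (simp add: minus_one_power_diff_double flip: binomial_symmetric)
  also have "\<dots> = 2 * (\<Sum>j<m. (-1) ^ j * of_nat (2 * m choose j)) + (-1) ^ m * of_nat (2 * m choose m)"
    by (simp add: sum_distrib_left)
  finally show ?thesis
    by (simp add: field_simps add_eq_0_iff)
qed

text \<open>If \<open>a b = c ^ 2\<close>, then \<open>1 / (a + c) + 1 / (b + c) = 1 / c\<close>.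
  With \<open>a = q ^ j\<close>, \<open>b = q ^ (2 * m - j)\<close> and \<open>c = q ^ m\<close>,
  averaging the sum with its reflection removes the dependence of the denominator on
  \<open>j\<close>.\<close>

lemma sum_alternating_binomial_div_eq_0:
  fixes q :: "'a::field_char_0"
  assumes nz: "\<And>i j. q ^ i + q ^ j \<noteq> 0" and "m > 0"
  shows "(\<Sum>j\<le>2 * m. (-1) ^ j * of_nat (2 * m choose j) / (q ^ j + q ^ m)) = 0" (is "sum ?f _ = 0")
proof -
  have pair: "1 / (a + c) + 1 / (b + c) = 1 / c"
    if "a * b = c * c" "a + c \<noteq> 0" "b + c \<noteq> 0" "c \<noteq> 0" for a b c :: 'a
    using that by (simp add: divide_simps) (simp add: algebra_simps)
  have q: "q ^ i \<noteq> 0" for i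
    using nz[of i i] by auto
  have "sum ?f {..2 * m} = (\<Sum>j\<le>2 * m. ?f (2 * m - j))"
    by (rule sum.reindex_bij_witness[of _ "\<lambda>j. 2 * m - j" "\<lambda>j. 2 * m - j"]) auto
  then have "2 * sum ?f {..2 * m} = (\<Sum>j\<le>2 * m. ?f j + ?f (2 * m - j))"
    by (simp add: sum.distrib)
  also have "\<dots> = (\<Sum>j\<le>2 * m. (-1) ^ j * of_nat (2 * m choose j) / q ^ m)"
  proof (intro sum.cong refl)
    fix j assume "j \<in> {..2 * m}"
    then have j: "j \<le> 2 * m" by simp
    then have "q ^ j * q ^ (2 * m - j) = q ^ m * q ^ m"
      by (simp add: mult_2 flip: power_add)
    from pair[OF this nz nz q]
    have *: "1 / (q ^ j + q ^ m) + 1 / (q ^ (2 * m - j) + q ^ m) = 1 / q ^ m" .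
    have "?f j + ?f (2 * m - j)
        = (-1) ^ j * of_nat (2 * m choose j) * (1 / (q ^ j + q ^ m) + 1 / (q ^ (2 * m - j) + q ^ m))"
      using j by (simp add: minus_one_power_diff_double distrib_left flip: binomial_symmetric)
    then show "?f j + ?f (2 * m - j) = (-1) ^ j * of_nat (2 * m choose j) / q ^ m"
      by (simp add: *)
  qed
  also have "\<dots> = (\<Sum>j\<le>2 * m. (-1) ^ j * of_nat (2 * m choose j)) / q ^ m"
    by (simp add: sum_divide_distrib)
  also have "\<dots> = 0"
    using assms(2) by (simp add: choose_alternating_sum)
  finally show ?thesis by simp
qed

lemma alternating_q_power_sum:
  fixes q :: "'a::field_char_0"
  assumes nz: "\<And>i j. q ^ i + q ^ j \<noteq> 0" and "m > 0"
  shows "(\<Sum>k = 1..n. (-1) ^ (n - k) * (1 - q ^ k) ^ (2 * m) * q ^ (m * (n - k)))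
    = (\<Sum>j\<le>2 * m. (-1) ^ j * of_nat (2 * m choose j) * (q ^ Suc n) ^ j / (q ^ j + q ^ m))"
proof -
  \<comment> \<open>The factorization of \<open>a ^ Suc n - b ^ Suc n\<close> with
    \<open>a = q ^ j\<close> and \<open>b = - (q ^ m)\<close>, so that \<open>a - b\<close> is the
    denominator.\<close>
  have geom: "(\<Sum>k\<le>n. (q ^ j) ^ k * (- (q ^ m)) ^ (n - k))
      = ((q ^ Suc n) ^ j - (- (q ^ m)) ^ Suc n) / (q ^ j + q ^ m)" for j
    using power_diff_sumr2[of "q ^ j" "Suc n" "- (q ^ m)"] nz[of j m]
    by (simp add: lessThan_Suc_atMost field_simps del: power_Suc flip: power_mult)
  \<comment> \<open>The term \<open>k = 0\<close> may be added because \<open>1 - q ^ 0 = 0\<close>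
    and \<open>m > 0\<close>; the geometric sums then start at 0.\<close>
  have "(\<Sum>k = 1..n. (-1) ^ (n - k) * (1 - q ^ k) ^ (2 * m) * q ^ (m * (n - k)))
      = (\<Sum>k\<le>n. (1 - q ^ k) ^ (2 * m) * (- (q ^ m)) ^ (n - k))"
  proof (rule sum.mono_neutral_cong_left)
    show "\<forall>i\<in>{..n} - {1..n}. (1 - q ^ i) ^ (2 * m) * (- (q ^ m)) ^ (n - i) = 0"
      using assms(2) by (auto simp: not_le)
    show "(-1) ^ (n - k) * (1 - q ^ k) ^ (2 * m) * q ^ (m * (n - k))
        = (1 - q ^ k) ^ (2 * m) * (- (q ^ m)) ^ (n - k)" for k
      by (simp add: power_minus[of "q ^ m"] power_mult)
  qed auto
  also have "\<dots> = (\<Sum>k\<le>n. (\<Sum>j\<le>2 * m. (-1) ^ j * of_nat (2 * m choose j) * (q ^ j) ^ k) * (- (q ^ m)) ^ (n - k))"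
  proof (intro sum.cong refl arg_cong2[of _ _ _ _ "(*)"])
    fix k
    show "(1 - q ^ k) ^ (2 * m) = (\<Sum>j\<le>2 * m. (-1) ^ j * of_nat (2 * m choose j) * (q ^ j) ^ k)"
      using binomial_ring[of "- (q ^ k)" 1 "2 * m"]
      by (simp add: power_minus[of "q ^ k"] mult_ac flip: power_mult)
  qed
  also have "\<dots> = (\<Sum>j\<le>2 * m. (-1) ^ j * of_nat (2 * m choose j) * (\<Sum>k\<le>n. (q ^ j) ^ k * (- (q ^ m)) ^ (n - k)))"
    unfolding sum_distrib_left sum_distrib_right
    by (subst sum.swap) (simp add: mult.assoc)
  also have "\<dots> = (\<Sum>j\<le>2 * m. (-1) ^ j * of_nat (2 * m choose j) * (q ^ Suc n) ^ j / (q ^ j + q ^ m))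
      - (\<Sum>j\<le>2 * m. (-1) ^ j * of_nat (2 * m choose j) / (q ^ j + q ^ m)) * (- (q ^ m)) ^ Suc n"
    unfolding geom sum_distrib_right sum_subtractf[symmetric]
    by (intro sum.cong refl) (simp add: diff_divide_distrib right_diff_distrib del: power_Suc)
  also have "\<dots> = (\<Sum>j\<le>2 * m. (-1) ^ j * of_nat (2 * m choose j) * (q ^ Suc n) ^ j / (q ^ j + q ^ m))"
    by (simp only: sum_alternating_binomial_div_eq_0[OF assms] mult_zero_left diff_zero)
  finally show ?thesis .
qed

section \<open>Expansion in powers of \<open>(1 - x) * (1 - q * x)\<close>\<close>

text \<open>Up to the sign \<open>(-1) ^ s\<close>, this is the outer sum in \<open>G\<close>. It
  stops at \<open>s\<close> because \<open>lucas_coeff q (m - k) (m - s)\<close> is 0 for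
  \<open>s < k \<le> m\<close>.\<close>

definition faulhaber_coeff :: "'a::field_char_0 \<Rightarrow> nat \<Rightarrow> nat \<Rightarrow> 'a" where
  "faulhaber_coeff q m s =
     (\<Sum>k\<le>s. (-1) ^ k * of_nat (2 * m choose k) / (1 + q ^ (m - k)) * lucas_coeff q (m - k) (m - s))"

lemma sum_binomial_eq_faulhaber:
  fixes q x :: "'a::field_char_0"
  assumes nz: "\<And>i j. q ^ i + q ^ j \<noteq> 0" and "m > 0" and x: "x \<noteq> 0"
  shows "(\<Sum>j\<le>2 * m. (-1) ^ j * of_nat (2 * m choose j) * (q * x) ^ j / (q ^ j + q ^ m))
    = (\<Sum>s<m. faulhaber_coeff q m s * (((1 - x) * (1 - q * x)) ^ (m - s) * x ^ s))"
proof -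
  define w where "w = (1 - x) * (1 - q * x) / x"
  define c where "c j = (-1) ^ j * of_nat (2 * m choose j) / (1 + q ^ (m - j))" for j
  have q0: "q ^ i \<noteq> 0" for i
    using nz[of i i] by auto
  have nz1: "1 + q ^ i \<noteq> 0" for i
    using nz[of 0 i] by simp
  have ab: "(1 / x) * (q * x) = q" and w: "1 / x + q * x = w + 1 + q"
    using x by (simp_all add: w_def field_simps)
  have pair: "of_nat (2 * m choose j) * (q * x) ^ j / (q ^ j + q ^ m) * (-1) ^ j
      + (-1) ^ (2 * m - j) * of_nat (2 * m choose (2 * m - j)) * (q * x) ^ (2 * m - j) / (q ^ (2 * m - j) + q ^ m)
      = c j * (\<Sum>r\<le>m. lucas_coeff q (m - j) r * w ^ r) * x ^ m" if j: "j < m" for j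
  proof -
    define d where "d = m - j"
    have j2: "j \<le> 2 * m" using j by simp
    have m: "m = j + d" and dj: "2 * m - j = j + d + d" using j by (simp_all add: d_def)
    \<comment> \<open>Cancelling \<open>q ^ j\<close> here and \<open>q ^ m\<close> in
      \<open>e2\<close> leaves the common denominator \<open>1 + q ^ d\<close>, with the powers
      \<open>d\<close> of the two bases \<open>1 / x\<close> and \<open>q * x\<close>.\<close>
    have e1: "(q * x) ^ j / (q ^ j + q ^ m) = (1 / x) ^ d / (1 + q ^ d) * x ^ m"
      using x nz1[of d] q0[of j] nz[of j m]
      by (simp add: m power_add power_mult_distrib divide_simps) (simp add: algebra_simps)
    have e2: "(q * x) ^ (2 * m - j) / (q ^ (2 * m - j) + q ^ m) = (q * x) ^ d / (1 + q ^ d) * x ^ m"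
      using x nz1[of d] q0[of j] nz[of "2 * m - j" m] unfolding dj
      by (simp add: m power_add power_mult_distrib divide_simps) (simp add: algebra_simps)
    have "of_nat (2 * m choose j) * (q * x) ^ j / (q ^ j + q ^ m) * (-1) ^ j
      + (-1) ^ (2 * m - j) * of_nat (2 * m choose (2 * m - j)) * (q * x) ^ (2 * m - j) / (q ^ (2 * m - j) + q ^ m)
      = (-1) ^ j * of_nat (2 * m choose j) *
          ((q * x) ^ j / (q ^ j + q ^ m) + (q * x) ^ (2 * m - j) / (q ^ (2 * m - j) + q ^ m))"
      unfolding minus_one_power_diff_double[OF j2]
      using j by (simp add: algebra_simps flip: binomial_symmetric)
    also have "\<dots> = c j * ((1 / x) ^ d + (q * x) ^ d) * x ^ m"
      unfolding e1 e2 c_def by (simp add: add_divide_distrib algebra_simps flip: d_def)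
    also have "(1 / x) ^ d + (q * x) ^ d = (\<Sum>r\<le>m. lucas_coeff q d r * w ^ r)"
      by (rule power_sum_lucas_coeff[OF ab w]) (simp add: m)
    finally show ?thesis unfolding d_def .
  qed
  have "(\<Sum>j\<le>2 * m. (-1) ^ j * of_nat (2 * m choose j) * (q * x) ^ j / (q ^ j + q ^ m))
      = (\<Sum>j<m. c j * (\<Sum>r\<le>m. lucas_coeff q (m - j) r * w ^ r) * x ^ m)
        + (-1) ^ m * of_nat (2 * m choose m) / 2 * x ^ m"
    unfolding sum_atMost_double
  proof (intro arg_cong2[of _ _ _ _ "(+)"] sum.cong refl)
    show "(-1) ^ m * of_nat (2 * m choose m) * (q * x) ^ m / (q ^ m + q ^ m)
        = (-1) ^ m * of_nat (2 * m choose m) / 2 * x ^ m"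
      using q0[of m] by (simp add: power_mult_distrib flip: mult_2)
  qed (use pair in \<open>simp add: mult_ac\<close>)
  \<comment> \<open>The terms \<open>r = 0\<close> are split off: their coefficient
    \<open>1 + q ^ (m - j)\<close> cancels the denominator of \<open>c j\<close>, and what remains
    cancels the middle term \<open>j = m\<close>.\<close>
  also have "(\<Sum>j<m. c j * (\<Sum>r\<le>m. lucas_coeff q (m - j) r * w ^ r) * x ^ m)
      = (\<Sum>j<m. c j * (1 + q ^ (m - j))) * x ^ m
        + (\<Sum>j<m. \<Sum>r = 1..m. c j * lucas_coeff q (m - j) r * (w ^ r * x ^ m))"
  proof -
    have "{..m} = insert 0 {1..m}" by auto
    then show ?thesis
      by (simp add: sum_distrib_left sum_distrib_right distrib_left distrib_right sum.distrib
            lucas_coeff_def[of _ _ 0] mult_ac)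
  qed
  also have "(\<Sum>j<m. c j * (1 + q ^ (m - j))) = (\<Sum>j<m. (-1) ^ j * of_nat (2 * m choose j))"
    by (simp add: c_def nz1)
  also have "\<dots> = - ((-1) ^ m * of_nat (2 * m choose m) / 2)"
    by (rule sum_alternating_binomial_half[OF assms(2)])
  also have "(\<Sum>j<m. \<Sum>r = 1..m. c j * lucas_coeff q (m - j) r * (w ^ r * x ^ m))
      = (\<Sum>s<m. faulhaber_coeff q m s * (w ^ (m - s) * x ^ m))"
  proof -
    \<comment> \<open>Substituting \<open>s = m - r\<close> makes the power of \<open>w\<close> the
      outer index after the swap.\<close>
    have "(\<Sum>j<m. \<Sum>r = 1..m. c j * lucas_coeff q (m - j) r * (w ^ r * x ^ m))
        = (\<Sum>j<m. \<Sum>s<m. c j * lucas_coeff q (m - j) (m - s) * (w ^ (m - s) * x ^ m))"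
      by (intro sum.cong refl sum.reindex_bij_witness[of _ "\<lambda>r. m - r" "\<lambda>r. m - r"]) auto
    also have "\<dots> = (\<Sum>s<m. \<Sum>j<m. c j * lucas_coeff q (m - j) (m - s) * (w ^ (m - s) * x ^ m))"
      by (rule sum.swap)
    also have "\<dots> = (\<Sum>s<m. \<Sum>j\<le>s. c j * lucas_coeff q (m - j) (m - s) * (w ^ (m - s) * x ^ m))"
      by (intro sum.cong refl sum.mono_neutral_right) (auto simp: lucas_coeff_eq_0)
    finally show ?thesis
      by (simp add: faulhaber_coeff_def sum_distrib_right c_def)
  qed
  also have "(\<Sum>s<m. faulhaber_coeff q m s * (w ^ (m - s) * x ^ m))
      = (\<Sum>s<m. faulhaber_coeff q m s * (((1 - x) * (1 - q * x)) ^ (m - s) * x ^ s))"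
  proof (intro sum.cong refl)
    fix s assume "s \<in> {..<m}"
    then have "x ^ m = x ^ (m - s) * x ^ s" by (simp flip: power_add)
    then have "w ^ (m - s) * x ^ m = ((1 - x) * (1 - q * x)) ^ (m - s) * x ^ s"
      using x by (simp add: w_def power_divide)
    then show "faulhaber_coeff q m s * (w ^ (m - s) * x ^ m)
        = faulhaber_coeff q m s * (((1 - x) * (1 - q * x)) ^ (m - s) * x ^ s)"
      by simp
  qed
  finally show ?thesis by simp
qed

section \<open>Divisibility by powers of a linear polynomial\<close>

lemma linear_power_dvd_mult_cancel:
  fixes a b :: "'a::idom poly"
  assumes "[:- c, 1:] ^ k dvd a * b" "poly b c \<noteq> 0"
  shows "[:- c, 1:] ^ k dvd a"
proof (cases "a = 0")
  case False
  have "b \<noteq> 0" "order c b = 0"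
    using assms(2) by (auto simp: order_root)
  with assms(1) False show ?thesis
    by (simp add: order_divides order_mult)
qed simp

text \<open>If a power of \<open>x - c\<close> divides all these combinations, then at \<open>c\<close> they give a polynomial
  with infinitely many roots \<open>z n\<close>, so one factor \<open>x - c\<close> can be split off every \<open>B s\<close>.\<close>
lemma linear_power_dvd_coeffs:
  fixes B :: "nat \<Rightarrow> 'a::idom poly"
  assumes inf: "infinite (z ` M)"
    and V: "\<And>n s. n \<in> M \<Longrightarrow> s < m \<Longrightarrow> poly (V n s) c = z n ^ (m - s)"
    and dvd: "\<And>n. n \<in> M \<Longrightarrow> [:- c, 1:] ^ e dvd (\<Sum>s<m. B s * V n s)"
    and "s < m"
  shows "[:- c, 1:] ^ e dvd B s"
  using dvd \<open>s < m\<close>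
proof (induction e arbitrary: s)
  case (Suc e)
  let ?l = "[:- c, 1:]"
  have "?l ^ e dvd B s" if "s < m" for s
    using Suc.IH[OF dvd_trans[OF le_imp_power_dvd Suc.prems(1)] that] by simp
  then have "\<forall>s. \<exists>b. s < m \<longrightarrow> B s = ?l ^ e * b"
    by (meson dvdE)
  then obtain b where b: "\<And>s. s < m \<Longrightarrow> B s = ?l ^ e * b s"
    by metis
  define P where "P = (\<Sum>s<m. monom (poly (b s) c) (m - s))"
  have "poly P (z n) = 0" if "n \<in> M" for n
  proof -
    have "(\<Sum>s<m. B s * V n s) = ?l ^ e * (\<Sum>s<m. b s * V n s)"
      by (simp add: b sum_distrib_left mult.assoc)
    then have "?l ^ e * ?l dvd ?l ^ e * (\<Sum>s<m. b s * V n s)"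
      using Suc.prems(1)[OF that] by (simp only: power_Suc2)
    moreover have "?l ^ e \<noteq> 0" by simp
    ultimately have "?l dvd (\<Sum>s<m. b s * V n s)"
      by (metis dvd_mult_cancel_left)
    then have "poly (\<Sum>s<m. b s * V n s) c = 0"
      by (simp only: poly_eq_0_iff_dvd)
    then show ?thesis
      using that by (simp add: P_def poly_sum poly_monom V)
  qed
  then have "z ` M \<subseteq> {x. poly P x = 0}" by auto
  with inf have "P = 0"
    using poly_roots_finite finite_subset by blast
  \<comment> \<open>The exponents \<open>m - s\<close> are distinct for \<open>s < m\<close>, so
    each coefficient of \<open>P\<close> is a single value \<open>poly (b s) c\<close>.\<close>
  moreover have "coeff P (m - s) = (\<Sum>t<m. if t = s then poly (b t) c else 0)"
    unfolding P_def coeff_sum using Suc.prems(2) by (intro sum.cong) auto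
  ultimately have "poly (b s) c = 0"
    using Suc.prems(2) by simp
  then have "?l dvd b s"
    by (simp only: poly_eq_0_iff_dvd)
  then show ?case
    using b[OF Suc.prems(2)] by (metis mult_dvd_mono dvd_refl power_Suc2)
qed simp

section \<open>The subring Z[q] of the field of fractions\<close>

lemma poly_in_q_altdef: "poly_in_q p = to_fract (pcompose p [:0, 0, 1:])"
  by (simp add: poly_in_q_def to_fract_def)

lemma poly_in_q_0 [simp]: "poly_in_q 0 = 0"
  and poly_in_q_1 [simp]: "poly_in_q 1 = 1"
  and poly_in_q_add [simp]: "poly_in_q (a + b) = poly_in_q a + poly_in_q b"
  and poly_in_q_diff [simp]: "poly_in_q (a - b) = poly_in_q a - poly_in_q b"
  and poly_in_q_uminus [simp]: "poly_in_q (- a) = - poly_in_q a"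
  and poly_in_q_mult [simp]: "poly_in_q (a * b) = poly_in_q a * poly_in_q b"
  by (simp_all add: poly_in_q_altdef pcompose_add pcompose_diff pcompose_uminus pcompose_mult pcompose_1)

lemma poly_in_q_power [simp]: "poly_in_q (a ^ k) = poly_in_q a ^ k"
  by (induction k) simp_all

lemma poly_in_q_sum [simp]: "poly_in_q (sum f I) = (\<Sum>i\<in>I. poly_in_q (f i))"
  by (induction I rule: infinite_finite_induct) simp_all

lemma poly_in_q_prod [simp]: "poly_in_q (prod f I) = (\<Prod>i\<in>I. poly_in_q (f i))"
  by (induction I rule: infinite_finite_induct) simp_all

lemma poly_in_q_of_nat [simp]: "poly_in_q (of_nat k) = of_nat k"
  by (induction k) simp_all

lemma poly_in_q_X [simp]: "poly_in_q [:0, 1:] = qq"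
  by (simp add: poly_in_q_def qq_def qh_def pcompose_pCons power2_eq_square)

text \<open>Composition with the nonconstant polynomial \<open>[:0, 0, 1:]\<close> is injective.
  Identities in the field can thus be pulled back to Z[q].\<close>

lemma poly_in_q_eq_iff [simp]: "poly_in_q a = poly_in_q b \<longleftrightarrow> a = b"
proof -
  have "poly_in_q a = poly_in_q b \<longleftrightarrow> pcompose (a - b) [:0, 0, 1:] = 0"
    by (simp add: poly_in_q_altdef pcompose_diff)
  also have "\<dots> \<longleftrightarrow> a = b"
    by (subst pcompose_eq_0_iff) auto
  finally show ?thesis .
qed

lemma range_poly_in_q_closed:
  shows range_poly_in_q_0: "0 \<in> range poly_in_q"
    and range_poly_in_q_1: "1 \<in> range poly_in_q"
    and range_poly_in_q_qq: "qq \<in> range poly_in_q"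
    and range_poly_in_q_of_nat: "of_nat k \<in> range poly_in_q"
    and range_poly_in_q_add: "x \<in> range poly_in_q \<Longrightarrow> y \<in> range poly_in_q \<Longrightarrow> x + y \<in> range poly_in_q"
    and range_poly_in_q_diff: "x \<in> range poly_in_q \<Longrightarrow> y \<in> range poly_in_q \<Longrightarrow> x - y \<in> range poly_in_q"
    and range_poly_in_q_uminus: "x \<in> range poly_in_q \<Longrightarrow> - x \<in> range poly_in_q"
    and range_poly_in_q_mult: "x \<in> range poly_in_q \<Longrightarrow> y \<in> range poly_in_q \<Longrightarrow> x * y \<in> range poly_in_q"
  by (auto simp flip: poly_in_q_0 poly_in_q_1 poly_in_q_X poly_in_q_of_nat poly_in_q_add
        poly_in_q_diff poly_in_q_uminus poly_in_q_mult)

lemma range_poly_in_q_power: "x \<in> range poly_in_q \<Longrightarrow> x ^ k \<in> range poly_in_q"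
  by (induction k) (auto intro: range_poly_in_q_closed)

lemma range_poly_in_q_sum: "(\<And>i. i \<in> I \<Longrightarrow> f i \<in> range poly_in_q) \<Longrightarrow> sum f I \<in> range poly_in_q"
  by (induction I rule: infinite_finite_induct) (auto intro: range_poly_in_q_closed)

lemma range_poly_in_q_prod: "(\<And>i. i \<in> I \<Longrightarrow> f i \<in> range poly_in_q) \<Longrightarrow> prod f I \<in> range poly_in_q"
  by (induction I rule: infinite_finite_induct) (auto intro: range_poly_in_q_closed)

lemmas range_poly_in_q_intros =
  range_poly_in_q_closed range_poly_in_q_power range_poly_in_q_sum range_poly_in_q_prod

text \<open>The factor \<open>d / r\<close> hides integrality in the closed form, but the recurrence
  and its initial values lie in Z[q].\<close>

lemma lucas_coeff_in_range: "lucas_coeff qq d r \<in> range poly_in_q"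
proof (induction d arbitrary: r rule: induct_nat_012)
  case 0
  have "lucas_coeff qq 0 r = of_nat (if r = 0 then 2 else 0)"
    by (simp add: lucas_coeff_def)
  then show ?case
    by (metis range_poly_in_q_of_nat)
next
  case 1
  have "lucas_coeff qq (Suc 0) r = (if r = 0 then 1 + qq else if r = 1 then 1 else 0)"
    by (simp add: lucas_coeff_def)
  then show ?case
    by (auto intro!: range_poly_in_q_intros)
next
  case (ge2 d)
  then show ?case
    using lucas_coeff_rec[of qq d r] by (auto intro!: range_poly_in_q_intros)
qed

text \<open>At \<open>q = 1\<close> the sum is 2. This supplies the assumption \<open>nz\<close> of
  the general identities.\<close>

lemma qq_power_add_nonzero: "qq ^ i + qq ^ j \<noteq> 0"
proof
  assume "qq ^ i + qq ^ j = 0"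
  then have "poly_in_q ([:0, 1:] ^ i + [:0, 1:] ^ j) = poly_in_q 0"
    by simp
  then have "poly ([:0, 1:] ^ i + [:0, 1:] ^ j :: int poly) 1 = 0"
    unfolding poly_in_q_eq_iff by simp
  then show False by simp
qed

lemma one_plus_qq_power_nonzero: "1 + qq ^ i \<noteq> 0"
  using qq_power_add_nonzero[of 0 i] by simp

lemma qq_nonzero: "qq \<noteq> 0"
  using qq_power_add_nonzero[of 1 1] by auto

lemma one_minus_qq_nonzero: "1 - qq \<noteq> 0"
proof
  assume "1 - qq = 0"
  then have "poly_in_q (1 - [:0, 1:]) = poly_in_q 0"
    by simp
  then have "poly (1 - [:0, 1:] :: int poly) 0 = 0"
    unfolding poly_in_q_eq_iff by simp
  then show False by simp
qed

section \<open>Specialization to \<open>G\<close> and \<open>T\<close>\<close>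

lemma G_eq_faulhaber_coeff:
  assumes "s < m"
  shows "G m s = (-1) ^ s * (faulhaber_coeff qq m s * (\<Prod>j = 0..s. 1 + qq ^ (m - j))) / (1 - qq) ^ (2 * s)"
proof -
  have "(\<Sum>k = 0..s. (-1) ^ (s - k) / (1 + qq ^ (m - k)) * of_nat ((2 * m) choose k) *
        (\<Sum>i = 0..s - k. of_nat (m - k) / of_nat (m - s) * of_nat ((m - s + i - 1) choose i)
            * of_nat ((m - k - i - 1) choose (s - k - i)) * qq ^ (s - k - i)))
      = (-1) ^ s * faulhaber_coeff qq m s"
    unfolding faulhaber_coeff_def atLeast0AtMost sum_distrib_left[of "(-1) ^ s"]
  proof (intro sum.cong refl)
    fix k assume "k \<in> {..s}"
    then have k: "k \<le> s" by simp
    have L: "lucas_coeff qq (m - k) (m - s)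
        = (\<Sum>i\<le>s - k. of_nat (m - k) / of_nat (m - s) * of_nat ((m - s + i - 1) choose i)
            * of_nat ((m - k - i - 1) choose (s - k - i)) * qq ^ (s - k - i))"
    proof -
      have "m - k - (m - s) = s - k" using k assms by simp
      then show ?thesis
        using k assms by (simp add: lucas_coeff_def sum_distrib_left atLeast0AtMost mult.assoc)
    qed
    have "(-1) ^ (s - k) = (-1) ^ s * ((-1) ^ k :: int poly fract)"
      using k by (auto simp: uminus_power_if)
    then show "(-1) ^ (s - k) / (1 + qq ^ (m - k)) * of_nat ((2 * m) choose k) *
        (\<Sum>i\<le>s - k. of_nat (m - k) / of_nat (m - s) * of_nat ((m - s + i - 1) choose i)
            * of_nat ((m - k - i - 1) choose (s - k - i)) * qq ^ (s - k - i))
      = (-1) ^ s * ((-1) ^ k * of_nat (2 * m choose k) / (1 + qq ^ (m - k)) * lucas_coeff qq (m - k) (m - s))"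
      unfolding L[symmetric] by simp
  qed
  then show ?thesis
    unfolding G_def by (simp add: mult_ac)
qed

text \<open>The even exponent \<open>2 * m\<close> turns the powers of \<open>qh\<close> into powers
  of \<open>qq\<close>; the general expansion is then taken at \<open>x = qq ^ n\<close>.\<close>

lemma T_eq_faulhaber:
  assumes "m > 0"
  shows "(1 - qq) ^ (2 * m) * T (2 * m) n =
    (\<Sum>s<m. faulhaber_coeff qq m s * (((1 - qq ^ n) * (1 - qq ^ (n + 1))) ^ (m - s) * qq ^ (s * n)))"
proof -
  have "(1 - qq) ^ (2 * m) * T (2 * m) n
      = (\<Sum>k = 1..n. (-1) ^ (n - k) * (1 - qq ^ k) ^ (2 * m) * qq ^ (m * (n - k)))"
    unfolding T_def sum_distrib_left
  proof (intro sum.cong refl)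
    fix k
    have "qh ^ (2 * m * (n - k)) = qq ^ (m * (n - k))"
      by (simp add: qq_def mult.assoc flip: power_mult)
    then show "(1 - qq) ^ (2 * m) * ((-1) ^ (n - k) * ((1 - qq ^ k) / (1 - qq)) ^ (2 * m)
          * qh ^ (2 * m * (n - k)))
        = (-1) ^ (n - k) * (1 - qq ^ k) ^ (2 * m) * qq ^ (m * (n - k))"
      using one_minus_qq_nonzero by (simp add: power_divide)
  qed
  also have "\<dots> = (\<Sum>j\<le>2 * m. (-1) ^ j * of_nat (2 * m choose j) * (qq * qq ^ n) ^ j / (qq ^ j + qq ^ m))"
    using alternating_q_power_sum[OF qq_power_add_nonzero assms, of n] by simp
  also have "\<dots> = (\<Sum>s<m. faulhaber_coeff qq m s * (((1 - qq ^ n) * (1 - qq * qq ^ n)) ^ (m - s) * (qq ^ n) ^ s))"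
    by (rule sum_binomial_eq_faulhaber[OF qq_power_add_nonzero assms]) (simp add: qq_nonzero)
  finally show ?thesis
    by (simp add: mult.commute flip: power_mult)
qed

section \<open>Integrality of \<open>G\<close>\<close>

lemma T_in_range: "T (2 * m) n \<in> range poly_in_q"
proof -
  have "(1 - qq ^ k) / (1 - qq) = (\<Sum>i<k. qq ^ i)" for k
    using one_minus_qq_nonzero by (simp add: one_diff_power_eq)
  moreover have "qh ^ (2 * m * k) = qq ^ (m * k)" for k
    by (simp add: qq_def mult.assoc flip: power_mult)
  ultimately show ?thesis
    unfolding T_def by (simp only:) (intro range_poly_in_q_intros)
qed

text \<open>Each denominator \<open>1 + qq ^ (m - k)\<close> with \<open>k \<le> s\<close> is itself
  a factor of the product.\<close>

lemma faulhaber_coeff_numerator: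
  "faulhaber_coeff qq m s * (\<Prod>j = 0..s. 1 + qq ^ (m - j)) \<in> range poly_in_q"
  unfolding faulhaber_coeff_def sum_distrib_right
proof (intro range_poly_in_q_sum)
  fix k assume "k \<in> {..s}"
  then have "(\<Prod>j = 0..s. 1 + qq ^ (m - j)) = (1 + qq ^ (m - k)) * (\<Prod>j \<in> {0..s} - {k}. 1 + qq ^ (m - j))"
    by (intro prod.remove) auto
  then have "(-1) ^ k * of_nat (2 * m choose k) / (1 + qq ^ (m - k)) * lucas_coeff qq (m - k) (m - s)
        * (\<Prod>j = 0..s. 1 + qq ^ (m - j))
      = (-1) ^ k * of_nat (2 * m choose k) * lucas_coeff qq (m - k) (m - s)
        * (\<Prod>j \<in> {0..s} - {k}. 1 + qq ^ (m - j))"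
    using one_plus_qq_power_nonzero[of "m - k"] by simp
  also have "\<dots> \<in> range poly_in_q"
    by (intro range_poly_in_q_intros lucas_coeff_in_range)
  finally show "(-1) ^ k * of_nat (2 * m choose k) / (1 + qq ^ (m - k)) * lucas_coeff qq (m - k) (m - s)
        * (\<Prod>j = 0..s. 1 + qq ^ (m - j)) \<in> range poly_in_q" .
qed

lemma G_in_range:
  assumes "s < m"
  shows "G m s \<in> range poly_in_q"
proof -
  have m: "m > 0" using assms by simp
  define X :: "int poly" where "X = [:0, 1:]"
  have phi_X: "poly_in_q X = qq" and X_at_1: "poly X 1 = 1"
    by (simp_all add: X_def)
  define l :: "int poly" where "l = [:- 1, 1:]"
  have l: "1 - X = - l" by (simp add: X_def l_def one_pCons)
  have "\<forall>s. \<exists>p. faulhaber_coeff qq m s * (\<Prod>j = 0..s. 1 + qq ^ (m - j)) = poly_in_q p"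
    using faulhaber_coeff_numerator by (meson rangeE)
  then obtain N where N: "\<And>s. faulhaber_coeff qq m s * (\<Prod>j = 0..s. 1 + qq ^ (m - j)) = poly_in_q (N s)"
    by metis
  \<comment> \<open>\<open>E s\<close> extends the denominator product for \<open>s\<close> to the
    product \<open>D\<close>, common to all \<open>s\<close>, by which the identity for
    \<open>T\<close> is multiplied.\<close>
  define E where "E s = (\<Prod>j = Suc s..m. 1 + X ^ (m - j))" for s
  define D where "D = (\<Prod>j = 0..m. 1 + X ^ (m - j))"
  define num :: "nat \<Rightarrow> int poly" where "num n = (\<Sum>i<n. X ^ i)" for n
  have num: "1 - X ^ n = - l * num n" for n
    by (simp add: num_def one_diff_power_eq flip: l)
  have NE: "poly_in_q (N s * E s) = faulhaber_coeff qq m s * poly_in_q D" if "s < m" for s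
  proof -
    have "{0..m} = {0..s} \<union> {Suc s..m}" using that by auto
    then have "D = (\<Prod>j = 0..s. 1 + X ^ (m - j)) * E s"
      unfolding D_def E_def by (simp add: prod.union_disjoint)
    then show ?thesis
      by (simp add: N[symmetric] phi_X)
  qed
  \<comment> \<open>Each \<open>1 - X ^ n\<close> equals \<open>- l * num n\<close>, so the term for
    \<open>s\<close> carries \<open>l ^ (2 * (m - s))\<close>, which is put into \<open>B s\<close>.
    What is left has value \<open>(n * (n + 1)) ^ (m - s)\<close> at 1, since \<open>num n\<close>
    is \<open>n\<close> there.\<close>
  have "l ^ (2 * m) dvd N s * E s * l ^ (2 * (m - s))"
    unfolding l_def
  proof (rule linear_power_dvd_coeffs[where M = UNIV and z = "\<lambda>n. int n * int (n + 1)"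
        and B = "\<lambda>s. N s * E s * [:- 1, 1:] ^ (2 * (m - s))"
        and V = "\<lambda>n s. (num n * num (n + 1)) ^ (m - s) * X ^ (s * n)"])
    let ?z = "\<lambda>n. int n * int (n + 1)"
    have "inj ?z"
      by (rule strict_mono_imp_inj_on) (auto simp: strict_mono_def intro!: mult_strict_mono)
    then show "infinite (range ?z)"
      using finite_imageD infinite_UNIV_nat by blast
    show "poly ((num n * num (n + 1)) ^ (m - s) * X ^ (s * n)) 1 = ?z n ^ (m - s)" for n s
      by (simp add: num_def poly_sum X_at_1 add.commute)
    show "[:- 1, 1:] ^ (2 * m) dvd (\<Sum>s<m. N s * E s * [:- 1, 1:] ^ (2 * (m - s))
        * ((num n * num (n + 1)) ^ (m - s) * X ^ (s * n)))" for n
    proof -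
      obtain t where t: "T (2 * m) n = poly_in_q t"
        using T_in_range by blast
      have "poly_in_q ((1 - X) ^ (2 * m) * t * D)
          = (1 - qq) ^ (2 * m) * T (2 * m) n * poly_in_q D"
        by (simp add: t phi_X)
      also have "\<dots> = (\<Sum>s<m. (faulhaber_coeff qq m s * poly_in_q D)
          * (((1 - qq ^ n) * (1 - qq ^ (n + 1))) ^ (m - s) * qq ^ (s * n)))"
        unfolding T_eq_faulhaber[OF m] sum_distrib_right by (simp add: mult_ac)
      also have "\<dots> = (\<Sum>s<m. poly_in_q (N s * E s)
          * (((1 - qq ^ n) * (1 - qq ^ (n + 1))) ^ (m - s) * qq ^ (s * n)))"
        by (intro sum.cong refl) (simp only: NE lessThan_iff)
      also have "\<dots> = poly_in_q (\<Sum>s<m. N s * E s * (((1 - X ^ n) * (1 - X ^ (n + 1))) ^ (m - s) * X ^ (s * n)))"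
        by (simp add: phi_X)
      finally have "(1 - X) ^ (2 * m) * t * D
          = (\<Sum>s<m. N s * E s * (((1 - X ^ n) * (1 - X ^ (n + 1))) ^ (m - s) * X ^ (s * n)))"
        by (simp only: poly_in_q_eq_iff)
      also have "\<dots> = (\<Sum>s<m. N s * E s * l ^ (2 * (m - s)) * ((num n * num (n + 1)) ^ (m - s) * X ^ (s * n)))"
        by (intro sum.cong refl) (simp only: num, simp add: power_mult_distrib power_mult power2_eq_square mult_ac)
      finally show ?thesis
        unfolding l l_def[symmetric] by (metis dvd_triv_left mult.assoc power_minus_even power_mult)
    qed
  qed (use assms in auto)
  moreover have "2 * m = 2 * s + 2 * (m - s)"
    using assms by simp
  then have "l ^ (2 * m) = l ^ (2 * s) * l ^ (2 * (m - s))"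
    by (metis power_add)
  ultimately have "l ^ (2 * s) dvd N s * E s"
    by (simp add: l_def)
  \<comment> \<open>The value is \<open>2 ^ (m - s)\<close>, so \<open>E s\<close> contributes no
    factor \<open>l\<close>.\<close>
  moreover have "poly (E s) 1 \<noteq> 0"
    by (simp add: E_def poly_prod X_at_1)
  ultimately have "l ^ (2 * s) dvd N s"
    unfolding l_def by (rule linear_power_dvd_mult_cancel)
  then obtain p where "N s = (1 - X) ^ (2 * s) * p"
    unfolding l by auto
  then have "G m s = poly_in_q ((-1) ^ s * p)"
    using one_minus_qq_nonzero by (simp add: G_eq_faulhaber_coeff[OF assms] N phi_X)
  then show ?thesis by (rule range_eqI)
qed

theorem theorem1p3:
  fixes m n :: nat
  assumes "m \<ge> 1" and "n \<ge> 1"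
  shows "(\<forall>s. s \<le> m - 1 \<longrightarrow> (\<exists>p :: int poly. G m s = poly_in_q p)) \<and>
    T (2 * m) n =
      (\<Sum>k = 0..m - 1. (-1) ^ k * G m k *
         ((1 - qq ^ n) ^ (m - k) * (1 - qq ^ (n + 1)) ^ (m - k) * qq ^ (k * n)) /
         ((1 - qq) ^ (2 * m - 2 * k) * (\<Prod>i = 0..k. 1 + qq ^ (m - i))))"
proof
  show "\<forall>s. s \<le> m - 1 \<longrightarrow> (\<exists>p :: int poly. G m s = poly_in_q p)"
  proof (intro allI impI)
    fix s assume "s \<le> m - 1"
    then have "s < m" using assms(1) by simp
    then show "\<exists>p. G m s = poly_in_q p"
      using G_in_range by blast
  qed
  have "T (2 * m) n = (\<Sum>s<m. faulhaber_coeff qq m s *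
      (((1 - qq ^ n) * (1 - qq ^ (n + 1))) ^ (m - s) * qq ^ (s * n)) / (1 - qq) ^ (2 * m))"
    using T_eq_faulhaber[of m n, symmetric] assms(1) one_minus_qq_nonzero
    by (simp add: field_simps flip: sum_divide_distrib)
  also have "\<dots> = (\<Sum>k<m. (-1) ^ k * G m k *
         ((1 - qq ^ n) ^ (m - k) * (1 - qq ^ (n + 1)) ^ (m - k) * qq ^ (k * n)) /
         ((1 - qq) ^ (2 * m - 2 * k) * (\<Prod>i = 0..k. 1 + qq ^ (m - i))))"
  proof (intro sum.cong refl)
    fix k assume "k \<in> {..<m}"
    then have k: "k < m" by simp
    define P where "P = (\<Prod>i = 0..k. 1 + qq ^ (m - i))"
    define u where "u = 1 - qq"
    have P: "P \<noteq> 0"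
      by (simp add: P_def one_plus_qq_power_nonzero)
    have u: "u \<noteq> 0"
      unfolding u_def by (rule one_minus_qq_nonzero)
    have u_pow: "u ^ (2 * m) = u ^ (2 * k) * u ^ (2 * m - 2 * k)"
      using k by (simp flip: power_add)
    have sign: "(-1) ^ k * (-1) ^ k = (1 :: int poly fract)"
      by (simp flip: power_mult_distrib)
    \<comment> \<open>Here \<open>e\<close> is the sign \<open>(-1) ^ k\<close>, which occurs once
      in the statement and once in \<open>G\<close>; \<open>a\<close> and \<open>b\<close> are the
      two parts of \<open>u ^ (2 * m)\<close>.\<close>
    have cancel: "f * v / (a * b) = e * (e * (f * P) / a) * v / (b * P)"
      if "e * e = 1" "a \<noteq> 0" "b \<noteq> 0" for e f v a b :: "int poly fract"
      using that P by (simp add: divide_simps)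
    show "faulhaber_coeff qq m k * (((1 - qq ^ n) * (1 - qq ^ (n + 1))) ^ (m - k) * qq ^ (k * n)) / (1 - qq) ^ (2 * m)
        = (-1) ^ k * G m k * ((1 - qq ^ n) ^ (m - k) * (1 - qq ^ (n + 1)) ^ (m - k) * qq ^ (k * n)) /
         ((1 - qq) ^ (2 * m - 2 * k) * (\<Prod>i = 0..k. 1 + qq ^ (m - i)))"
      unfolding G_eq_faulhaber_coeff[OF k] P_def[symmetric] u_def[symmetric] u_pow power_mult_distrib
      by (rule cancel[OF sign]) (simp_all add: u)
  qed
  also have "{..<m} = {0..m - 1}"
    using assms(1) by auto
  finally show "T (2 * m) n =
      (\<Sum>k = 0..m - 1. (-1) ^ k * G m k *
         ((1 - qq ^ n) ^ (m - k) * (1 - qq ^ (n + 1)) ^ (m - k) * qq ^ (k * n)) /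
         ((1 - qq) ^ (2 * m - 2 * k) * (\<Prod>i = 0..k. 1 + qq ^ (m - i))))" .
qed

end
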